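(* Let $b\in\mathbb{Z}$ with $b\neq0$, and for positive integers $n$ let $f_n(x)=(x+b)^n-b$. For positive integers $m<n$, put $d=\gcd(m,n)$, $m=dm_1$, $n=dn_1$. Then \[ \gcd(f_m(x),f_n(x))=f_d(x) \] in each of the following cases: (1) $b=1$; (2) $b=-1$ and $\gcd(m_1,2)=\gcd(n_1,2)=1$. In all other cases, $f_m(x)$ and $f_n(x)$ are coprime.
   Context: The gcd of polynomials is the monic greatest common divisor in $\mathbb{Q}[x]$, and coprime means having gcd equal to $1$. *)

theory Defs
  imports
    "HOL-Computational_Algebra.Computational_Algebra"
    "HOL-Computational_Algebra.Field_as_Ring"
begin

definition fpoly :: "int \<Rightarrow> nat \<Rightarrow> rat poly" where
  "fpoly b n = [:of_int b, 1:] ^ n - [:of_int b:]"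

text \<open>The library \<open>gcd\<close> on \<open>rat poly\<close> is the monic greatest common divisor
  (and \<open>gcd 0 0 = 0\<close>).\<close>

lemma lead_coeff_gcd_rat_poly:
  fixes p q :: "rat poly"
  assumes "p \<noteq> 0 \<or> q \<noteq> 0"
  shows "lead_coeff (gcd p q) = 1"
proof -
  have "gcd p q \<noteq> 0"
    using assms by simp
  then have "lead_coeff (normalize (gcd p q)) = 1"
    by (simp add: normalize_poly_eq_map_poly degree_map_poly coeff_map_poly)
  then show ?thesis
    by simp
qed

end

theory Submission imports Defs begin

text \<open>Put \<open>y = x + b\<close>. Modulo \<open>g = gcd (f\<^sub>m, f\<^sub>n)\<close> we have \<open>y ^ m \<equiv> b \<equiv> y ^ n\<close>,
  so computing \<open>y ^ (d m\<^sub>1 n\<^sub>1)\<close> in two ways shows that \<open>g\<close> divides the constant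
  \<open>b ^ n\<^sub>1 - b ^ m\<^sub>1\<close>. If this constant is nonzero, then \<open>g = 1\<close>. It vanishes only in the
  exceptional cases, in which \<open>b ^ m\<^sub>1 = b = b ^ n\<^sub>1\<close>; then \<open>f\<^sub>d\<close> divides both polynomials, and
  a Bezout relation \<open>m\<^sub>1 u = n\<^sub>1 v + 1\<close> yields \<open>b ^ v y ^ d \<equiv> b ^ u = b ^ v b\<close> modulo \<open>g\<close>.\<close>

lemma diff_dvd_diff_power:
  fixes x y :: "'a::comm_ring_1"
  shows "x - y dvd x ^ k - y ^ k"
  by (simp add: power_diff_sumr2)

lemma dvd_diff_power:
  fixes g y c :: "'a::comm_ring_1"
  assumes "g dvd y ^ m - c"
  shows "g dvd y ^ (m * k) - c ^ k"
  using dvd_trans[OF assms diff_dvd_diff_power[of "y ^ m" c k]] by (simp add: power_mult)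

text \<open>Raising the first congruence to the power \<open>n\<close> and the second to the power
  \<open>m\<close> gives two values of \<open>y ^ (d * m * n)\<close> modulo
  \<open>g\<close>.\<close>

lemma dvd_power_diff_power:
  fixes g y c :: "'a::comm_ring_1"
  assumes "g dvd y ^ (d * m) - c" and "g dvd y ^ (d * n) - c"
  shows "g dvd c ^ n - c ^ m"
proof -
  have "g dvd y ^ (d * n * m) - c ^ m" "g dvd y ^ (d * m * n) - c ^ n"
    using assms by (auto intro: dvd_diff_power)
  then have "g dvd (y ^ (d * n * m) - c ^ m) - (y ^ (d * m * n) - c ^ n)"
    by (rule dvd_diff)
  then show ?thesis
    by (simp add: ac_simps)
qed

text \<open>A Bezout relation isolates \<open>y ^ d\<close> up to a factor \<open>c ^ v\<close>,
  which can be cancelled because \<open>c\<close> is a unit.\<close>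

lemma dvd_power_gcd_diff:
  fixes g y c :: "'a::comm_ring_1"
  assumes "g dvd y ^ (d * m) - c" and "g dvd y ^ (d * n) - c"
    and "coprime m n" and "m \<noteq> 0" and "c ^ m = c" and "c ^ n = c" and "c dvd 1"
  shows "g dvd y ^ d - c"
proof -
  obtain u v where uv: "m * u = n * v + 1"
    using bezout_nat[OF \<open>m \<noteq> 0\<close>, of n] \<open>coprime m n\<close> by (auto simp: coprime_iff_gcd_eq_1)
  have "c ^ u = c ^ (m * u)"
    by (simp add: power_mult \<open>c ^ m = c\<close>)
  also have "\<dots> = c ^ v * c"
    by (simp add: uv power_mult \<open>c ^ n = c\<close>)
  finally have c: "c ^ u = c ^ v * c" .
  have y: "y ^ (d * m * u) = y ^ (d * n * v) * y ^ d"
    by (simp add: mult.assoc uv distrib_left power_add)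
  \<comment> \<open>The second congruence is multiplied by \<open>y ^ d\<close>, so that the powers
    of \<open>y\<close> cancel by \<open>y\<close>.\<close>
  have "g dvd (y ^ (d * m * u) - c ^ u) - (y ^ (d * n * v) - c ^ v) * y ^ d"
    by (rule dvd_diff[OF dvd_diff_power[OF assms(1)] dvd_mult2[OF dvd_diff_power[OF assms(2)]]])
  also have "\<dots> = c ^ v * (y ^ d - c)"
    unfolding c y by (simp add: algebra_simps)
  finally have "g dvd c ^ v * (y ^ d - c)" .
  moreover obtain e where "c ^ v * e = 1"
    using dvd_power_same[OF \<open>c dvd 1\<close>, of v] by (auto simp: dvd_def)
  ultimately show ?thesis
    using dvd_mult[of g "c ^ v * (y ^ d - c)" e] by (simp add: mult.assoc[symmetric] mult.commute[of e])
qed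

text \<open>Powers of \<open>\<bar>b\<bar>\<close> are injective in the exponent when
  \<open>\<bar>b\<bar> > 1\<close>; otherwise \<open>b\<close> is 1 or -1 and only parity
  matters.\<close>

lemma int_power_eq_power_iff:
  fixes b :: int
  assumes "b \<noteq> 0" and "m \<noteq> n"
  shows "b ^ m = b ^ n \<longleftrightarrow> b = 1 \<or> (b = -1 \<and> (even m \<longleftrightarrow> even n))"
proof (cases "\<bar>b\<bar> = 1")
  case True
  then have "b = 1 \<or> b = -1"
    by linarith
  then show ?thesis
    by (auto simp: minus_one_power_iff split: if_splits)
next
  case False
  then have "\<bar>b\<bar> > 1"
    using \<open>b \<noteq> 0\<close> by linarith
  then have "\<bar>b\<bar> ^ m \<noteq> \<bar>b\<bar> ^ n"
    using \<open>m \<noteq> n\<close> by (simp add: power_inject_exp)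
  then have "b ^ m \<noteq> b ^ n"
    by (metis power_abs)
  then show ?thesis
    using False by auto
qed

text \<open>For positive \<open>n\<close> the subtracted constant leaves the leading coefficient 1.
  Being monic makes \<open>fpoly b d\<close> equal to the gcd, not merely associated to it.\<close>

lemma normalize_fpoly:
  assumes "0 < n"
  shows "normalize (fpoly b n) = fpoly b n"
proof -
  have "degree (fpoly b n) = n"
    unfolding fpoly_def diff_conv_add_uminus
    using assms by (subst degree_add_eq_left) (simp_all add: degree_linear_power)
  then have "lead_coeff (fpoly b n) = 1"
    using assms by (simp add: fpoly_def coeff_linear_power coeff_pCons split: nat.split)
  then show ?thesis
    by (simp add: normalize_poly_eq_map_poly)
qed

theorem corollary3p4:
  fixes b :: int and m n d m1 n1 :: nat
  assumes "b \<noteq> 0"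
    and "0 < m" and "m < n"
    and "d = gcd m n" and "m = d * m1" and "n = d * n1"
  shows "(b = 1 \<or> (b = -1 \<and> gcd m1 2 = 1 \<and> gcd n1 2 = 1) \<longrightarrow>
            gcd (fpoly b m) (fpoly b n) = fpoly b d)
       \<and> (\<not> (b = 1 \<or> (b = -1 \<and> gcd m1 2 = 1 \<and> gcd n1 2 = 1)) \<longrightarrow>
            gcd (fpoly b m) (fpoly b n) = 1)"
proof -
  let ?y = "[:of_int b, 1:] :: rat poly" and ?c = "[:of_int b:] :: rat poly"
  let ?exc = "b = 1 \<or> (b = -1 \<and> gcd m1 2 = 1 \<and> gcd n1 2 = 1)"
  have pos: "0 < d" "m1 \<noteq> 0" "m1 \<noteq> n1"
    using \<open>0 < m\<close> \<open>m < n\<close> unfolding \<open>m = d * m1\<close> \<open>n = d * n1\<close> by auto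
  have "d * gcd m1 n1 = gcd m n"
    unfolding \<open>m = d * m1\<close> \<open>n = d * n1\<close> by (simp add: gcd_mult_distrib_nat)
  also have "\<dots> = d"
    by (rule \<open>d = gcd m n\<close>[symmetric])
  finally have cop: "coprime m1 n1"
    using pos(1) by (simp add: coprime_iff_gcd_eq_1)
  have odd: "gcd k 2 = 1 \<longleftrightarrow> odd k" for k :: nat
    by (metis coprime_iff_gcd_eq_1 coprime_right_2_iff_odd)
  have unit: "is_unit ?c"
    using \<open>b \<noteq> 0\<close> by (simp add: is_unit_pCons_iff)
  have dvd: "g dvd ?y ^ (d * m1) - ?c" "g dvd ?y ^ (d * n1) - ?c"
    if "g dvd fpoly b m" "g dvd fpoly b n" for g
    using that unfolding fpoly_def \<open>m = d * m1\<close> \<open>n = d * n1\<close> by auto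
  have "gcd (fpoly b m) (fpoly b n) = fpoly b d" if ?exc
  proof -
    have pow: "?c ^ m1 = ?c" "?c ^ n1 = ?c"
      using that unfolding odd by (auto simp: poly_const_pow)
    show ?thesis
    proof (rule sym, rule gcdI)
      \<comment> \<open>Here \<open>?y ^ (d * k) - ?c ^ k\<close> is \<open>fpoly b (d * k)\<close>
        itself.\<close>
      have "fpoly b d dvd fpoly b (d * k)" if "?c ^ k = ?c" for k
        unfolding fpoly_def using dvd_diff_power[of "?y ^ d - ?c" ?y d ?c k] that by simp
      with pow show "fpoly b d dvd fpoly b m" "fpoly b d dvd fpoly b n"
        unfolding \<open>m = d * m1\<close> \<open>n = d * n1\<close> by blast+
      show "normalize (fpoly b d) = fpoly b d"
        using pos(1) by (rule normalize_fpoly)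
      show "g dvd fpoly b d" if "g dvd fpoly b m" "g dvd fpoly b n" for g
        unfolding fpoly_def[of b d]
        using dvd[OF that] cop \<open>m1 \<noteq> 0\<close> pow unit by (rule dvd_power_gcd_diff)
    qed
  qed
  moreover have "gcd (fpoly b m) (fpoly b n) = 1" if "\<not> ?exc"
  proof -
    \<comment> \<open>For \<open>b = -1\<close>, equality would need exponents of equal parity;
      coprimality rules out both even, and both odd is exceptional.\<close>
    have "b ^ m1 \<noteq> b ^ n1"
      using that cop pos \<open>b \<noteq> 0\<close> unfolding odd by (auto simp: int_power_eq_power_iff)
    then have "(of_int b :: rat) ^ n1 - of_int b ^ m1 \<noteq> 0"
      by (simp flip: of_int_power)
    \<comment> \<open>A nonzero constant is invertible over the rationals.\<close>
    then have "is_unit (?c ^ n1 - ?c ^ m1)"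
      by (simp add: poly_const_pow is_unit_pCons_iff)
    then have "is_unit g" if "g dvd fpoly b m" "g dvd fpoly b n" for g
      using dvd_power_diff_power[OF dvd[OF that]] dvd_trans by blast
    then show ?thesis
      by (intro coprime_imp_gcd_eq_1 coprimeI)
  qed
  ultimately show ?thesis
    by blast
qed

end
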